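(* Let $m\ge2$, $r=\frac1{4m}$, and for real $v$ let $$\Psi_r(v)=\frac{1+v-\sqrt{(1-v)^2+\frac1m}}{2}.$$ Define $w_0:=\frac12$ and $w_{k+1}:=\Psi_r(w_k)$ for $k=0,1,\dots,m-2$. Then the limit $p_\top(m):=\lim_{n\to\infty}g_n^{(m-1)}/g_n$ exists and $$p_\top(m)=\prod_{k=0}^{m-2}\partial_v\Psi_r(w_k)=\prod_{k=0}^{m-2}\frac12\left(1+\frac{1-w_k}{\sqrt{(1-w_k)^2+\frac1m}}\right).$$
   Context: For an integer $m\ge2$ let $V_m=\{v_0<v_1<\cdots<v_{m-1}\}$ ($v_0=0$, $v_{m-1}=1$) be an $m$-element chain with Gödel implication $v_p\Rightarrow_G v_q=v_{m-1}$ if $p\le q$ and $v_p\Rightarrow_G v_q=v_q$ if $p>q$. For $n\ge1$, consider the $C_{n-1}$ full bracketings of $p_1\Rightarrow_G\cdots\Rightarrow_G p_n$ in $n$ distinct variables (full binary trees with $n$ ordered leaves), $C_k$ being the Catalan numbers. Let $g_n^{(j)}$ be the number of pairs (bracketing, valuation $\{p_1,\dots,p_n\}\to V_m$) for which the bracketed formula evaluates to $v_j$, and $g_n=\sum_{j=0}^{m-1}g_n^{(j)}=m^nC_{n-1}$. *)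

theory Defs
  imports "HOL-Analysis.Analysis"
begin

datatype fm = Var nat | Imp fm fm

fun leaves :: "fm \<Rightarrow> nat list" where
  "leaves (Var i) = [i]"
| "leaves (Imp a b) = leaves a @ leaves b"

text \<open>The full bracketings of \<open>p\<^sub>1 \<Rightarrow> \<dots> \<Rightarrow> p\<^sub>n\<close>: formulas whose leaves,
  read from left to right, are the variables \<open>1, \<dots>, n\<close>. There is none for \<open>n = 0\<close>.\<close>

definition bracketings :: "nat \<Rightarrow> fm set" where
  "bracketings n = {f. leaves f = [1..<Suc n]}"

text \<open>Goedel implication on a chain with top element \<open>1\<close>.\<close>

definition goedel_imp :: "'a::{linorder,one} \<Rightarrow> 'a \<Rightarrow> 'a" where
  "goedel_imp x y = (if x \<le> y then 1 else y)"

fun eval_fm :: "(nat \<Rightarrow> 'a::{linorder,one}) \<Rightarrow> fm \<Rightarrow> 'a" where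
  "eval_fm \<sigma> (Var i) = \<sigma> i"
| "eval_fm \<sigma> (Imp a b) = goedel_imp (eval_fm \<sigma> a) (eval_fm \<sigma> b)"

definition is_chain :: "nat \<Rightarrow> (nat \<Rightarrow> 'a::{linorder,zero,one}) \<Rightarrow> bool" where
  "is_chain m v \<longleftrightarrow> strict_mono_on {..<m} v \<and> v 0 = 0 \<and> v (m - 1) = 1"

text \<open>Valuations are extensional functions, so that each map from the \<open>n\<close> variables
  to the chain is counted exactly once.\<close>

definition gcount :: "nat \<Rightarrow> (nat \<Rightarrow> 'a::{linorder,zero,one}) \<Rightarrow> nat \<Rightarrow> nat \<Rightarrow> nat" where
  "gcount m v j n =
     card {(f, \<sigma>). f \<in> bracketings n \<and> \<sigma> \<in> {1..n} \<rightarrow>\<^sub>E v ` {..<m} \<and> eval_fm \<sigma> f = v j}"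

definition gtotal :: "nat \<Rightarrow> (nat \<Rightarrow> 'a::{linorder,zero,one}) \<Rightarrow> nat \<Rightarrow> nat" where
  "gtotal m v n = (\<Sum>j<m. gcount m v j n)"

text \<open>\<open>Psi m\<close> is the function \<open>\<Psi>\<^sub>r\<close> with \<open>r = 1 / (4 m)\<close>; thus \<open>1 / m = 4 r\<close>.\<close>

definition Psi :: "nat \<Rightarrow> real \<Rightarrow> real" where
  "Psi m v = (1 + v - sqrt ((1 - v)\<^sup>2 + 1 / real m)) / 2"

fun wseq :: "nat \<Rightarrow> nat \<Rightarrow> real" where
  "wseq m 0 = 1 / 2"
| "wseq m (Suc k) = Psi m (wseq m k)"

text \<open>The sets counted by \<^const>\<open>gcount\<close> are finite, so \<^const>\<open>card\<close> is their true size.\<close>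

lemma leaves_nonempty: "leaves f \<noteq> []"
  by (induction f) auto

lemma finite_leaves: "finite {f. leaves f = xs}"
proof (induction xs rule: length_induct)
  case (1 xs)
  let ?S = "\<lambda>ys. {f. leaves f = ys}"
  let ?B = "(\<Union>i\<in>{0<..<length xs}. (\<lambda>(a, b). Imp a b) ` (?S (take i xs) \<times> ?S (drop i xs)))"
  have "?S xs \<subseteq> Var ` set xs \<union> ?B"
  proof
    fix f assume "f \<in> ?S xs"
    then have f: "leaves f = xs" by simp
    show "f \<in> Var ` set xs \<union> ?B"
    proof (cases f)
      case (Var i)
      then show ?thesis using f by auto
    next
      case (Imp a b)
      then have "length (leaves a) \<in> {0<..<length xs}"
        using f leaves_nonempty[of a] leaves_nonempty[of b] by auto
      moreover have "(a, b) \<in> ?S (take (length (leaves a)) xs) \<times> ?S (drop (length (leaves a)) xs)"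
        using f Imp by auto
      ultimately show ?thesis using Imp by blast
    qed
  qed
  moreover have "finite ?B"
    using 1 by (intro finite_UN_I finite_imageI finite_cartesian_product) auto
  ultimately show ?case by (meson finite_UnI finite_imageI finite_set finite_subset)
qed

lemma finite_gcount:
  fixes v :: "nat \<Rightarrow> 'a::{linorder,zero,one}"
  shows "finite {(f, \<sigma>). f \<in> bracketings n \<and> \<sigma> \<in> {1..n} \<rightarrow>\<^sub>E v ` {..<m} \<and> eval_fm \<sigma> f = v j}"
proof (rule finite_subset)
  show "finite (bracketings n \<times> ({1..n} \<rightarrow>\<^sub>E v ` {..<m}))"
    unfolding bracketings_def by (intro finite_cartesian_product finite_leaves finite_PiE) auto
qed auto

end

theory Submission
  imports Defs "HOL-Computational_Algebra.Formal_Power_Series" "HOL-Real_Asymp.Real_Asymp"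
begin

unbundle no vec_syntax and fps_syntax

text \<open>
  Scale all counts by \<open>(4 m)\<close> to the power \<open>-n\<close>. The series of all pairs then satisfies
  \<open>c = X/4 + c\<^sup>2\<close>; hence its sum is \<open>1/2\<close> and \<open>c\<^sub>n\<^sub>+\<^sub>1 / c\<^sub>n \<rightarrow> 1\<close>. Let \<open>T\<^sub>k\<close> count the pairs of
  value at least \<open>v\<^sub>k\<close> and \<open>E\<^sub>k\<close> those of value exactly \<open>v\<^sub>k\<close>. Then \<open>T\<^sub>k = E\<^sub>k + T\<^sub>k\<^sub>+\<^sub>1\<close> and,
  below the top, \<open>E\<^sub>k = X/(4 m) + T\<^sub>k\<^sub>+\<^sub>1 E\<^sub>k\<close>, which at \<open>X = 1\<close> gives \<open>T\<^sub>k\<^sub>+\<^sub>1 = \<Psi>\<^sub>r(T\<^sub>k)\<close>.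

  Instead of singularity analysis, the coefficients are compared directly with \<open>c\<^sub>n\<close>. Since
  \<open>c\<^sub>n\<close> is the self-convolution of \<open>c\<close>, only the two ends of a convolution of series below \<open>c\<close>
  contribute asymptotically. If \<open>T\<^sub>k\<close> has a limiting ratio to \<open>c\<close>, an asymptotic error \<open>\<epsilon>\<close> for
  \<open>T\<^sub>k\<^sub>+\<^sub>1\<close> is one for \<open>E\<^sub>k\<close>, and the equation of \<open>E\<^sub>k\<close> improves it to \<open>\<epsilon>\<close> times the sum of \<open>T\<^sub>k\<close>,
  which is at most \<open>1/2\<close>. So the error vanishes and the ratio gets multiplied by the derivative of \<open>\<Psi>\<^sub>r\<close>.
\<close>

section \<open>Asymptotic error bounds and the splitting of convolutions\<close>

text \<open>Errors measured in multiples of \<open>c n\<close> can be added and convolved without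
  any division; limits of ratios are handled in this form below.\<close>

lemma tendsto_ratio_iff:
  assumes "\<And>n. n \<ge> 1 \<Longrightarrow> (c :: nat \<Rightarrow> real) n > 0"
  shows "(\<lambda>n. a n / c n) \<longlonglongrightarrow> \<alpha> \<longleftrightarrow>
     (\<forall>\<epsilon>>0. \<forall>\<^sub>F n in sequentially. \<bar>a n - \<alpha> * c n\<bar> \<le> \<epsilon> * c n)"
proof -
  have *: "(\<bar>a n - \<alpha> * c n\<bar> \<le> \<epsilon> * c n) = (dist (a n / c n) \<alpha> \<le> \<epsilon>)" if "n \<ge> 1" for n \<epsilon>
  proof -
    have "dist (a n / c n) \<alpha> = \<bar>(a n - \<alpha> * c n) / c n\<bar>"
      using assms[OF that] by (simp add: dist_real_def field_simps)
    then show ?thesis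
      using assms[OF that] by (simp add: abs_divide pos_divide_le_eq)
  qed
  show ?thesis
  proof (intro iffI allI impI)
    fix \<epsilon> :: real
    assume "(\<lambda>n. a n / c n) \<longlonglongrightarrow> \<alpha>" "\<epsilon> > 0"
    then have "\<forall>\<^sub>F n in sequentially. dist (a n / c n) \<alpha> < \<epsilon>"
      by (rule tendstoD)
    then show "\<forall>\<^sub>F n in sequentially. \<bar>a n - \<alpha> * c n\<bar> \<le> \<epsilon> * c n"
      using eventually_ge_at_top[of 1] by eventually_elim (simp add: *)
  next
    assume bound: "\<forall>\<epsilon>>0. \<forall>\<^sub>F n in sequentially. \<bar>a n - \<alpha> * c n\<bar> \<le> \<epsilon> * c n"
    show "(\<lambda>n. a n / c n) \<longlonglongrightarrow> \<alpha>"
    proof (rule tendstoI)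
      fix \<epsilon> :: real assume "\<epsilon> > 0"
      then have "\<forall>\<^sub>F n in sequentially. \<bar>a n - \<alpha> * c n\<bar> \<le> \<epsilon>/2 * c n"
        using bound half_gt_zero by blast
      then show "\<forall>\<^sub>F n in sequentially. dist (a n / c n) \<alpha> < \<epsilon>"
        using eventually_ge_at_top[of 1]
      proof eventually_elim
        case (elim n)
        then show ?case using *[of n "\<epsilon>/2"] \<open>\<epsilon> > 0\<close> by simp
      qed
    qed
  qed
qed

text \<open>The upper end is reversed by \<open>k -> n - k\<close>. Both ends then run over the
  fixed range \<open>k < K\<close>, with one factor at a bounded index and the other near
  \<open>n\<close>.\<close>

lemma conv_split:
  fixes a b :: "nat \<Rightarrow> real"
  assumes "2 * K \<le> n"
  shows "(\<Sum>k\<le>n. a k * b (n - k)) = (\<Sum>k<K. a k * b (n - k)) + (\<Sum>k<K. b k * a (n - k))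
           + (\<Sum>k=K..n - K. a k * b (n - k))"
proof -
  have "{..n} = ({..<K} \<union> {K..n - K}) \<union> {n - K<..n}"
    using assms by auto
  then have "(\<Sum>k\<le>n. a k * b (n - k)) = (\<Sum>k<K. a k * b (n - k))
      + (\<Sum>k=K..n - K. a k * b (n - k)) + (\<Sum>k\<in>{n - K<..n}. a k * b (n - k))"
    by (simp only:) (subst sum.union_disjoint; (subst sum.union_disjoint)?; use assms in auto)
  moreover have "(\<Sum>k\<in>{n - K<..n}. a k * b (n - k)) = (\<Sum>k<K. b k * a (n - k))"
    by (rule sum.reindex_bij_witness[of _ "\<lambda>k. n - k" "\<lambda>k. n - k"]) (use assms in auto)
  ultimately show ?thesis by simp
qed

section \<open>The scaled Catalan series\<close>

text \<open>This is \<open>(1 - sqrt (1 - X)) / 2\<close>, with coefficients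
  \<open>C_{n-1} / 4^n\<close>; the vanishing constant term selects this root of the quadratic
  equation.\<close>

locale catalan_series =
  fixes c :: "real fps"
  assumes nth_0: "c $ 0 = 0"
    and quadratic: "c = fps_const (1/4) * fps_X + c * c"
begin

text \<open>Differentiation gives \<open>c' (1 - 2 c) = 1/4\<close>, and the quadratic equation
  reads \<open>(1 - 2 c)^2 = 1 - X\<close>. Together they yield the linear equation
  \<open>(1 - X) c' = (1 - 2 c) / 4\<close>, whose coefficients give the recurrence; at
  \<open>n = 0\<close> the constant 1 would interfere.\<close>

lemma nth_Suc: "real (2 * n + 2) * c $ Suc n = real (2 * n - 1) * c $ n" if "n \<ge> 1"
proof -
  have "fps_deriv c = fps_deriv (fps_const (1/4) * fps_X + c * c)"
    using quadratic by simp
  then have "fps_deriv c = fps_const (1/4) + 2 * c * fps_deriv c"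
    by (simp add: algebra_simps)
  then have d: "fps_deriv c * (1 - 2 * c) = fps_const (1/4)"
    by (simp add: algebra_simps)
  have "4 * c = 4 * (fps_const (1/4) * fps_X + c * c)"
    using quadratic by simp
  moreover have "4 * fps_const (1/4 :: real) = 1"
    by (simp add: numeral_fps_const)
  ultimately have "4 * c = fps_X + 4 * (c * c)"
    by (simp add: distrib_left mult.assoc[symmetric])
  then have "(1 - 2 * c) * (1 - 2 * c) = 1 - fps_X"
    by (simp add: algebra_simps)
  then have "fps_deriv c * (1 - fps_X) = fps_deriv c * (1 - 2 * c) * (1 - 2 * c)"
    by (metis mult.assoc)
  also have "\<dots> = fps_const (1/4) * (1 - 2 * c)"
    by (simp add: d)
  finally have "(fps_deriv c * (1 - fps_X)) $ n = (fps_const (1/4) * (1 - 2 * c)) $ n"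
    by simp
  moreover have "(2 * c) $ n = 2 * c $ n"
    by (simp add: numeral_fps_const)
  ultimately have "real (n + 1) * c $ (n + 1) - real n * c $ n = - (c $ n) / 2"
    using that by (simp add: right_diff_distrib fps_X_mult_right_nth)
  then show ?thesis
    using that by (simp add: of_nat_diff algebra_simps)
qed

lemma nth_1: "c $ 1 = 1/4"
proof -
  have "c $ 1 = (fps_const (1/4) * fps_X + c * c) $ 1"
    using quadratic by simp
  then show ?thesis
    by (simp add: fps_mult_nth nth_0)
qed

lemma conv: "(\<Sum>i\<le>n. c $ i * c $ (n - i)) = c $ n" if "n \<ge> 2"
proof -
  have "c $ n = (fps_const (1/4) * fps_X + c * c) $ n"
    using quadratic by simp
  then show ?thesis
    using that by (simp add: mult.assoc fps_mult_nth[of c c] atLeast0AtMost)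
qed

lemma pos: "c $ n > 0" if "n \<ge> 1"
  using that
proof (induction n rule: dec_induct)
  case base
  then show ?case using nth_1 by simp
next
  case (step n)
  then have "real (2 * n + 2) * c $ Suc n > 0"
    using nth_Suc[of n] by simp
  then show ?case
    by (simp add: zero_less_mult_iff)
qed

lemma nonneg: "c $ n \<ge> 0"
  using pos[of n] nth_0 by (cases n) auto

text \<open>The recurrence says \<open>c_n = 2 n c_n - 2 (n + 1) c_{n+1}\<close> for
  \<open>n \<ge> 1\<close>, so the sum telescopes.\<close>

lemma partial_sum: "(\<Sum>n\<le>N. c $ n) = 1/2 - 2 * real (N + 1) * c $ (N + 1)"
proof (induction N)
  case 0
  then show ?case using nth_0 nth_1 by simp
next
  case (Suc N)
  then show ?case
    using nth_Suc[of "Suc N"] by (simp add: algebra_simps)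
qed

text \<open>The partial sums are bounded by 1/2, hence converge; the sum then solves
  \<open>S = 1/4 + S * S\<close>, which has the double root 1/2.\<close>

lemma sums_half: "(\<lambda>n. c $ n) sums (1/2)"
proof -
  have s: "summable (\<lambda>n. c $ n)"
  proof (rule summableI_nonneg_bounded)
    show "(\<Sum>n<N. c $ n) \<le> 1/2" for N
      using partial_sum[of "N - 1"] nonneg[of N] by (cases N) (auto simp: lessThan_Suc_atMost)
  qed (rule nonneg)
  define S where "S = (\<Sum>n. c $ n)"
  have "(\<lambda>n. \<Sum>i\<le>n. c $ i * c $ (n - i)) sums (S * S)"
    unfolding S_def using s nonneg by (intro Cauchy_product_sums) auto
  \<comment> \<open>The linear term of the quadratic equation makes degree 1 exceptional.\<close>
  moreover have "(\<Sum>i\<le>n. c $ i * c $ (n - i)) = c $ n - (if n = 1 then 1/4 else 0)" for n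
    using conv[of n] nth_0 nth_1 by (cases "n \<ge> 2") (auto simp: not_le less_2_cases_iff)
  moreover have "(\<lambda>n. c $ n - (if n = 1 then 1/4 else 0)) sums (S - 1/4)"
    unfolding S_def by (intro sums_diff summable_sums s sums_single[of 1 "\<lambda>_. 1/4"])
  ultimately have "S * S = S - 1/4"
    by (simp add: sums_unique2)
  then have "(S - 1/2) * (S - 1/2) = 0"
    by (simp add: algebra_simps)
  then show ?thesis
    using s unfolding S_def by (auto simp: sums_iff)
qed

text \<open>By the recurrence, the ratio of neighbours is an explicit rational function of
  \<open>n\<close>; the ratio over distance \<open>k\<close> is a product of \<open>k\<close> of
  these.\<close>

lemma ratio_shift: "(\<lambda>n. c $ (n - k) / c $ n) \<longlonglongrightarrow> 1"
proof -
  have step: "(\<lambda>n. c $ n / c $ Suc n) \<longlonglongrightarrow> 1"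
  proof (rule Lim_transform_eventually)
    show "(\<lambda>n. real (2 * n + 2) / (2 * real n - 1)) \<longlonglongrightarrow> 1"
      by real_asymp
    show "\<forall>\<^sub>F n in sequentially. real (2 * n + 2) / (2 * real n - 1) = c $ n / c $ Suc n"
      using eventually_ge_at_top[of 1]
    proof eventually_elim
      case (elim n)
      then show ?case
        using nth_Suc[of n] pos[of "Suc n"]
        by (simp add: of_nat_diff divide_simps)
    qed
  qed
  \<comment> \<open>Shifting upwards avoids truncated subtraction; \<open>LIMSEQ_offset\<close>
    converts back.\<close>
  have "(\<lambda>n. c $ n / c $ (n + k)) \<longlonglongrightarrow> 1"
  proof (induction k)
    case 0
    show ?case
      using pos
      by (intro tendsto_eventually eventually_mono[OF eventually_ge_at_top[of 1]])
        (simp add: order_less_imp_not_eq2)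
  next
    case (Suc k)
    show ?case
    proof (rule Lim_transform_eventually)
      have "(\<lambda>n. c $ n / c $ (n + k) * (c $ (n + k) / c $ Suc (n + k))) \<longlonglongrightarrow> 1 * 1"
        by (intro tendsto_mult Suc LIMSEQ_ignore_initial_segment[OF step, of k])
      then show "(\<lambda>n. c $ n / c $ (n + k) * (c $ (n + k) / c $ Suc (n + k))) \<longlonglongrightarrow> 1"
        by simp
      have "c $ n / c $ (n + k) * (c $ (n + k) / c $ Suc (n + k)) = c $ n / c $ (n + Suc k)"
        if "1 \<le> n" for n
        using that pos[of "n + k"] by simp
      then show "\<forall>\<^sub>F n in sequentially.
          c $ n / c $ (n + k) * (c $ (n + k) / c $ Suc (n + k)) = c $ n / c $ (n + Suc k)"
        by (intro eventually_mono[OF eventually_ge_at_top[of 1]])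
    qed
  qed
  then have "(\<lambda>n. c $ (n + k - k) / c $ (n + k)) \<longlonglongrightarrow> 1"
    by simp
  then show ?thesis
    by (rule LIMSEQ_offset)
qed

section \<open>Convolutions of series dominated by \<open>c\<close>\<close>

lemma weighted_shift:
  "(\<lambda>n. \<Sum>k<K. a k * (c $ (n - k) / c $ n)) \<longlonglongrightarrow> (\<Sum>k<K. a k)"
  using tendsto_sum[of "{..<K}" "\<lambda>k n. a k * (c $ (n - k) / c $ n)" a]
    tendsto_mult[OF tendsto_const ratio_shift] by force

text \<open>As \<open>c * c\<close> agrees with \<open>c\<close> from degree 2 on and \<open>c\<close> has sum \<open>1/2\<close>, the two ends of
  the convolution already exhaust it.\<close>

lemma middle_small:
  assumes "\<eta> > 0"
  shows "\<forall>\<^sub>F K in sequentially. \<forall>\<^sub>F n in sequentially.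
           (\<Sum>k=K..n - K. c $ k * c $ (n - k)) \<le> \<eta> * c $ n"
proof -
  have "(\<lambda>K. \<Sum>k<K. c $ k) \<longlonglongrightarrow> 1/2"
    using sums_half by (simp add: sums_def)
  \<comment> \<open>Each of the two ends will carry more than \<open>1/2 - \<eta>/2\<close> of
    \<open>c $ n\<close>, which leaves at most \<open>\<eta>\<close> for the middle.\<close>
  then have "\<forall>\<^sub>F K in sequentially. (\<Sum>k<K. c $ k) > 1/2 - \<eta>/2"
    using assms by (intro order_tendstoD) auto
  then show ?thesis
  proof eventually_elim
    case (elim K)
    have "\<forall>\<^sub>F n in sequentially. (\<Sum>k<K. c $ k * (c $ (n - k) / c $ n)) > 1/2 - \<eta>/2"
      by (rule order_tendstoD(1)[OF weighted_shift elim])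
    then show ?case
      using eventually_ge_at_top[of "2 * K + 2"]
    proof eventually_elim
      case (elim n)
      have "c $ n > 0" using elim pos by simp
      then have "(\<Sum>k<K. c $ k * c $ (n - k)) > (1/2 - \<eta>/2) * c $ n"
        using elim(1) by (simp add: sum_divide_distrib[symmetric] pos_less_divide_eq)
      moreover have "c $ n = (\<Sum>k<K. c $ k * c $ (n - k)) + (\<Sum>k<K. c $ k * c $ (n - k))
          + (\<Sum>k=K..n - K. c $ k * c $ (n - k))"
        using conv[of n] conv_split[of K n "fps_nth c" "fps_nth c"] elim by simp
      ultimately show ?case by (simp add: algebra_simps)
    qed
  qed
qed

text \<open>For fixed \<open>K\<close>, \<open>b (n - k)\<close> is close to
  \<open>\<beta> * c $ (n - k)\<close>, which is asymptotically \<open>\<beta> * c $ n\<close>. The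
  given error is weighted by the sum of \<open>a\<close>; the slack \<open>\<eta>\<close> pays for
  replacing \<open>n - k\<close> by \<open>n\<close>.\<close>

lemma half_convolution:
  fixes a b :: "nat \<Rightarrow> real"
  assumes a: "\<And>k. a k \<ge> 0" and \<epsilon>: "\<epsilon> \<ge> 0" and \<eta>: "\<eta> > 0"
    and b: "\<forall>\<^sub>F n in sequentially. \<bar>b n - \<beta> * c $ n\<bar> \<le> \<epsilon> * c $ n"
  shows "\<forall>\<^sub>F n in sequentially.
    \<bar>(\<Sum>k<K. a k * b (n - k)) - \<beta> * (\<Sum>k<K. a k) * c $ n\<bar> \<le> (\<epsilon> * (\<Sum>k<K. a k) + \<eta>) * c $ n"
proof -
  define A where "A = (\<Sum>k<K. a k)"
  \<comment> \<open>\<open>w n\<close> is the end sum with \<open>c\<close> in place of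
    \<open>b\<close>, in units of \<open>c $ n\<close>; it tends to \<open>A\<close>.\<close>
  define w where "w = (\<lambda>n. \<Sum>k<K. a k * (c $ (n - k) / c $ n))"
  have "(\<lambda>n. (\<epsilon> + \<bar>\<beta>\<bar>) * \<bar>w n - A\<bar>) \<longlonglongrightarrow> (\<epsilon> + \<bar>\<beta>\<bar>) * \<bar>A - A\<bar>"
    unfolding w_def A_def by (intro tendsto_intros weighted_shift)
  then have small: "\<forall>\<^sub>F n in sequentially. (\<epsilon> + \<bar>\<beta>\<bar>) * \<bar>w n - A\<bar> < \<eta>"
    using \<eta> by (intro order_tendstoD) auto
  obtain N where N: "\<And>n. n \<ge> N \<Longrightarrow> \<bar>b n - \<beta> * c $ n\<bar> \<le> \<epsilon> * c $ n"
    using b by (auto simp: eventually_sequentially)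
  show ?thesis
    \<comment> \<open>This puts \<open>n - k\<close> above \<open>N\<close> for every
      \<open>k < K\<close>.\<close>
    using small eventually_ge_at_top[of "N + K + 1"]
  proof eventually_elim
    case (elim n)
    have cn: "c $ n > 0" using elim pos by simp
    have w: "(\<Sum>k<K. a k * c $ (n - k)) = w n * c $ n"
      using cn by (simp add: w_def sum_distrib_right)
    have "\<bar>(\<Sum>k<K. a k * b (n - k)) - \<beta> * (w n * c $ n)\<bar>
        = \<bar>\<Sum>k<K. a k * (b (n - k) - \<beta> * c $ (n - k))\<bar>"
      by (simp add: w[symmetric] sum_distrib_left sum_subtractf[symmetric] algebra_simps)
    also have "\<dots> \<le> (\<Sum>k<K. a k * (\<epsilon> * c $ (n - k)))"
      using a N elim by (intro sum_abs[THEN order_trans] sum_mono)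
        (auto simp: abs_mult intro!: mult_left_mono)
    also have "\<dots> = \<epsilon> * (w n * c $ n)"
      by (simp add: w[symmetric] sum_distrib_left algebra_simps)
    finally have 1: "\<bar>(\<Sum>k<K. a k * b (n - k)) - \<beta> * (w n * c $ n)\<bar> \<le> \<epsilon> * (w n * c $ n)" .
    have "\<bar>\<beta> * (w n * c $ n) - \<beta> * A * c $ n\<bar> = \<bar>\<beta>\<bar> * \<bar>w n - A\<bar> * c $ n"
    proof -
      have "\<beta> * (w n * c $ n) - \<beta> * A * c $ n = \<beta> * (w n - A) * c $ n"
        by (simp add: algebra_simps)
      then show ?thesis using cn by (simp add: abs_mult)
    qed
    moreover have "\<epsilon> * (w n * c $ n) \<le> (\<epsilon> * A + \<epsilon> * \<bar>w n - A\<bar>) * c $ n"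
    proof -
      have "\<epsilon> * w n \<le> \<epsilon> * (A + \<bar>w n - A\<bar>)"
        using \<epsilon> by (intro mult_left_mono) auto
      from mult_right_mono[OF this, of "c $ n"] show ?thesis
        using cn by (simp add: algebra_simps)
    qed
    moreover have "(\<epsilon> + \<bar>\<beta>\<bar>) * \<bar>w n - A\<bar> * c $ n \<le> \<eta> * c $ n"
      using elim(1) cn by (intro mult_right_mono) auto
    ultimately have "\<bar>(\<Sum>k<K. a k * b (n - k)) - \<beta> * A * c $ n\<bar> \<le> (\<epsilon> * A + \<eta>) * c $ n"
      using 1 by (simp add: algebra_simps)
    then show ?case by (simp add: A_def)
  qed
qed

text \<open>The end where \<open>b\<close> has the large index contributes
  \<open>A * \<beta>\<close>, the other end \<open>B * \<alpha>\<close>, and the middle is bounded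
  by that of \<open>c * c\<close>. The factor \<open>A + B\<close> in the error is at most 1/2 when
  this is applied, which makes the iteration below contract.\<close>

lemma convolution_asymptotics:
  fixes a b :: "real fps"
  assumes a: "\<And>n. 0 \<le> a $ n" "\<And>n. a $ n \<le> c $ n" "(\<lambda>n. a $ n) sums A"
    and b: "\<And>n. 0 \<le> b $ n" "\<And>n. b $ n \<le> c $ n" "(\<lambda>n. b $ n) sums B"
    and \<epsilon>: "\<epsilon> \<ge> 0" and \<eta>: "\<eta> > 0"
    and a_lim: "\<forall>\<^sub>F n in sequentially. \<bar>a $ n - \<alpha> * c $ n\<bar> \<le> \<epsilon> * c $ n"
    and b_lim: "\<forall>\<^sub>F n in sequentially. \<bar>b $ n - \<beta> * c $ n\<bar> \<le> \<epsilon> * c $ n"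
  shows "\<forall>\<^sub>F n in sequentially.
    \<bar>(a * b) $ n - (A * \<beta> + B * \<alpha>) * c $ n\<bar> \<le> ((A + B) * \<epsilon> + \<eta>) * c $ n"
proof -
  \<comment> \<open>The slack is spent as \<open>\<eta>/8\<close> for each truncated sum,
    \<open>\<eta>/8\<close> for each half convolution and \<open>\<eta>/4\<close> for the middle,
    \<open>3/4 * \<eta>\<close> in total.\<close>
  have close: "\<forall>\<^sub>F K in sequentially. \<bar>\<gamma>\<bar> * \<bar>(\<Sum>k<K. f k) - F\<bar> < \<eta>/8"
    if "f sums F" for f and F \<gamma> :: real
  proof -
    have "(\<lambda>K. \<bar>\<gamma>\<bar> * \<bar>(\<Sum>k<K. f k) - F\<bar>) \<longlonglongrightarrow> \<bar>\<gamma>\<bar> * \<bar>F - F\<bar>"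
      using that by (intro tendsto_intros) (simp add: sums_def)
    then show ?thesis using \<eta> by (intro order_tendstoD) auto
  qed
  have "\<forall>\<^sub>F K in sequentially.
      (\<forall>\<^sub>F n in sequentially. (\<Sum>k=K..n - K. c $ k * c $ (n - k)) \<le> \<eta>/4 * c $ n)
      \<and> \<bar>\<beta>\<bar> * \<bar>(\<Sum>k<K. a $ k) - A\<bar> < \<eta>/8 \<and> \<bar>\<alpha>\<bar> * \<bar>(\<Sum>k<K. b $ k) - B\<bar> < \<eta>/8"
    using \<eta> a(3) b(3) by (intro eventually_conj middle_small close) auto
  then obtain K where mid: "\<forall>\<^sub>F n in sequentially. (\<Sum>k=K..n - K. c $ k * c $ (n - k)) \<le> \<eta>/4 * c $ n"
    and KA: "\<bar>\<beta>\<bar> * \<bar>(\<Sum>k<K. a $ k) - A\<bar> < \<eta>/8" and KB: "\<bar>\<alpha>\<bar> * \<bar>(\<Sum>k<K. b $ k) - B\<bar> < \<eta>/8"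
    using eventually_happens[of _ sequentially] by fastforce
  define A' B' where "A' = (\<Sum>k<K. a $ k)" and "B' = (\<Sum>k<K. b $ k)"
  have le: "A' \<le> A" "B' \<le> B"
    unfolding A'_def B'_def using a(1,3) b(1,3) by (auto simp: sums_iff intro!: sum_le_suminf)
  have e8: "\<eta>/8 > 0" using \<eta> by simp
  have h1: "\<forall>\<^sub>F n in sequentially.
      \<bar>(\<Sum>k<K. a $ k * b $ (n - k)) - \<beta> * A' * c $ n\<bar> \<le> (\<epsilon> * A' + \<eta>/8) * c $ n"
    unfolding A'_def by (rule half_convolution) (use a \<epsilon> e8 b_lim in auto)
  have h2: "\<forall>\<^sub>F n in sequentially.
      \<bar>(\<Sum>k<K. b $ k * a $ (n - k)) - \<alpha> * B' * c $ n\<bar> \<le> (\<epsilon> * B' + \<eta>/8) * c $ n"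
    unfolding B'_def by (rule half_convolution) (use b \<epsilon> e8 a_lim in auto)
  show ?thesis
    using mid h1 h2 eventually_ge_at_top[of "2 * K + 1"]
  proof eventually_elim
    case (elim n)
    have cn: "c $ n > 0" using elim pos by simp
    define M where "M = (\<Sum>k=K..n - K. a $ k * b $ (n - k))"
    have split: "(a * b) $ n = (\<Sum>k<K. a $ k * b $ (n - k)) + (\<Sum>k<K. b $ k * a $ (n - k)) + M"
      using conv_split[of K n "fps_nth a" "fps_nth b"] elim
      by (simp add: fps_mult_nth atLeast0AtMost M_def)
    have "0 \<le> M"
      unfolding M_def using a b by (intro sum_nonneg) auto
    have "M \<le> (\<Sum>k=K..n - K. c $ k * c $ (n - k))"
      unfolding M_def using a b nonneg by (intro sum_mono mult_mono) auto
    then have M: "\<bar>M\<bar> \<le> \<eta>/4 * c $ n" using \<open>0 \<le> M\<close> elim(1) by simp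
    have "\<bar>\<beta> * A' * c $ n - A * \<beta> * c $ n\<bar> = \<bar>\<beta>\<bar> * \<bar>A' - A\<bar> * c $ n"
    proof -
      have "\<beta> * A' * c $ n - A * \<beta> * c $ n = \<beta> * (A' - A) * c $ n"
        by (simp add: algebra_simps)
      then show ?thesis using cn by (simp add: abs_mult)
    qed
    also have "\<dots> \<le> \<eta>/8 * c $ n"
      using KA cn unfolding A'_def by (intro mult_right_mono) auto
    finally have 1: "\<bar>\<beta> * A' * c $ n - A * \<beta> * c $ n\<bar> \<le> \<eta>/8 * c $ n" .
    have "\<bar>\<alpha> * B' * c $ n - B * \<alpha> * c $ n\<bar> = \<bar>\<alpha>\<bar> * \<bar>B' - B\<bar> * c $ n"
    proof -
      have "\<alpha> * B' * c $ n - B * \<alpha> * c $ n = \<alpha> * (B' - B) * c $ n"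
        by (simp add: algebra_simps)
      then show ?thesis using cn by (simp add: abs_mult)
    qed
    also have "\<dots> \<le> \<eta>/8 * c $ n"
      using KB cn unfolding B'_def by (intro mult_right_mono) auto
    finally have 2: "\<bar>\<alpha> * B' * c $ n - B * \<alpha> * c $ n\<bar> \<le> \<eta>/8 * c $ n" .
    have le_sum: "(\<epsilon> * A' + \<epsilon> * B') * c $ n \<le> (\<epsilon> * A + \<epsilon> * B) * c $ n"
      using le \<epsilon> cn by (intro mult_right_mono add_mono mult_left_mono) auto
    have expand:
      "((A + B) * \<epsilon> + \<eta>) * c $ n = (\<epsilon> * A + \<epsilon> * B) * c $ n + \<eta> * c $ n"
      "(\<epsilon> * A' + \<epsilon> * B') * c $ n = \<epsilon> * A' * c $ n + \<epsilon> * B' * c $ n"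
      "(\<epsilon> * A' + \<eta>/8) * c $ n = \<epsilon> * A' * c $ n + \<eta> * c $ n / 8"
      "(\<epsilon> * B' + \<eta>/8) * c $ n = \<epsilon> * B' * c $ n + \<eta> * c $ n / 8"
      "(A * \<beta> + B * \<alpha>) * c $ n = A * \<beta> * c $ n + B * \<alpha> * c $ n"
      by (simp_all only: distrib_right distrib_left times_divide_eq_left
          times_divide_eq_right mult.commute mult.left_commute)
    show ?case
      using le_sum M 1 2 elim(2,3) mult_pos_pos[OF \<eta> cn] unfolding expand split by linarith
  qed
qed

section \<open>Passage from one threshold to the next\<close>

text \<open>\<open>T\<close>, \<open>E\<close>, \<open>U\<close> stand for the series of values at
  least \<open>v k\<close>, equal to \<open>v k\<close>, and at least \<open>v (Suc k)\<close>.
  Existence of a limit for \<open>U\<close> is not presupposed: the error against the only candidate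
  is shown to shrink geometrically.\<close>

lemma contraction_step:
  fixes T E U :: "real fps"
  assumes sum: "T = E + U" and E: "E = fps_const r * fps_X + U * E"
    and EU_nonneg: "\<And>n. 0 \<le> E $ n" "\<And>n. 0 \<le> U $ n" and T_le: "\<And>n. T $ n \<le> c $ n"
    and r: "r > 0" and T_sums: "(\<lambda>n. T $ n) sums w" and T_lim: "(\<lambda>n. T $ n / c $ n) \<longlonglongrightarrow> \<tau>"
  shows "(\<lambda>n. U $ n) sums ((1 + w - sqrt ((1 - w)\<^sup>2 + 4 * r)) / 2)"
    and "(\<lambda>n. U $ n / c $ n) \<longlonglongrightarrow> \<tau> * (1/2 * (1 + (1 - w) / sqrt ((1 - w)\<^sup>2 + 4 * r)))"
proof -
  have le: "E $ n \<le> c $ n" "U $ n \<le> c $ n" for n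
    using T_le[of n] EU_nonneg[of n] sum by auto
  define u e where "u = (\<Sum>n. U $ n)" and "e = (\<Sum>n. E $ n)"
  have U_sums: "(\<lambda>n. U $ n) sums u" and E_sums: "(\<lambda>n. E $ n) sums e"
    unfolding u_def e_def using le EU_nonneg sums_half
    by (auto intro!: summable_sums summable_comparison_test'[of "fps_nth c" 0] simp: sums_iff)
  have "(\<lambda>n. T $ n) sums (e + u)"
    using sums_add[OF E_sums U_sums] sum by simp
  then have w: "w = e + u"
    using T_sums sums_unique2 by blast
  have "w \<le> 1/2"
    using sums_le[OF T_le T_sums sums_half] .
  have "0 \<le> u" "0 \<le> e"
    using sums_le[OF _ sums_zero U_sums] sums_le[OF _ sums_zero E_sums] EU_nonneg by auto
  have "(\<lambda>n. \<Sum>i\<le>n. U $ i * E $ (n - i)) sums (u * e)"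
    unfolding u_def e_def using U_sums E_sums EU_nonneg
    by (intro Cauchy_product_sums) (auto simp: sums_iff)
  then have "(\<lambda>n. (if n = 1 then r else 0) + (U * E) $ n) sums (r + u * e)"
    using sums_single[of 1 "\<lambda>_. r"] by (intro sums_add) (simp_all add: fps_mult_nth atLeast0AtMost)
  moreover have E_nth: "E $ n = (if n = 1 then r else 0) + (U * E) $ n" for n
    using arg_cong[OF E, of "\<lambda>f. f $ n"] by simp
  ultimately have e: "e = r + u * e"
    using E_sums sums_unique2 by (metis (no_types, lifting) ext)
  have "u < 1" using w \<open>w \<le> 1/2\<close> \<open>0 \<le> e\<close> by simp
  \<comment> \<open>Since \<open>w = e + u\<close>, \<open>s\<close> is \<open>(1 - u) + e\<close>,
    and \<open>e * (1 - u) = r\<close> turns its square into the radicand. Its positivity decides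
    the sign of the square root.\<close>
  define s where "s = 1 + w - 2 * u"
  have "s > 0" unfolding s_def using w \<open>w \<le> 1/2\<close> \<open>0 \<le> e\<close> \<open>0 \<le> u\<close> by simp
  have "s\<^sup>2 = (1 - w)\<^sup>2 + 4 * r"
    using e unfolding s_def w by (simp add: power2_eq_square algebra_simps)
  then have s: "sqrt ((1 - w)\<^sup>2 + 4 * r) = s"
    using \<open>s > 0\<close> by (metis real_sqrt_abs abs_of_pos)
  have "u = (1 + w - s) / 2" by (simp add: s_def)
  then show "(\<lambda>n. U $ n) sums ((1 + w - sqrt ((1 - w)\<^sup>2 + 4 * r)) / 2)"
    using U_sums s by metis

  \<comment> \<open>\<open>\<alpha>\<close> and \<open>\<beta>\<close> are the candidate ratios for
    \<open>U\<close> and \<open>E\<close>. They solve \<open>\<alpha> + \<beta> = \<tau>\<close> and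
    \<open>u * \<beta> + e * \<alpha> = \<beta>\<close>, which the two series equations become for
    ratios.\<close>
  define \<alpha> where "\<alpha> = \<tau> * (1/2 * (1 + (1 - w) / s))"
  define \<beta> where "\<beta> = \<tau> - \<alpha>"
  have \<alpha>_s: "\<alpha> * s = \<tau> * (1 - u)"
    using \<open>s > 0\<close> unfolding \<alpha>_def by (simp add: field_simps) (simp add: s_def algebra_simps)
  have \<beta>_s: "\<beta> * s = \<tau> * e"
    unfolding \<beta>_def left_diff_distrib \<alpha>_s by (simp add: s_def w algebra_simps)
  have "(u * \<beta> + e * \<alpha>) * s = u * (\<beta> * s) + e * (\<alpha> * s)"
    by (simp add: algebra_simps)
  also have "\<dots> = \<beta> * s"
    unfolding \<alpha>_s \<beta>_s by (simp add: algebra_simps)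
  finally have fixpoint: "u * \<beta> + e * \<alpha> = \<beta>" using \<open>s > 0\<close> by simp

  define P where "P = (\<lambda>\<epsilon>. \<forall>\<^sub>F n in sequentially. \<bar>U $ n - \<alpha> * c $ n\<bar> \<le> \<epsilon> * c $ n)"
  have T_bound: "\<forall>\<^sub>F n in sequentially. \<bar>T $ n - \<tau> * c $ n\<bar> \<le> \<epsilon> * c $ n" if "\<epsilon> > 0" for \<epsilon>
    using T_lim tendsto_ratio_iff[OF pos, where a = "fps_nth T" and \<alpha> = \<tau>] that by auto
  \<comment> \<open>Going from \<open>U\<close> to \<open>E\<close> through \<open>T\<close> costs
    \<open>\<epsilon>/4\<close>, giving 5/4. The convolution multiplies by
    \<open>u + e \<le> 1/2\<close> and adds 1/16, giving 11/16; going back to \<open>U\<close> costs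
    another 1/16.\<close>
  have improve: "P (3/4 * \<epsilon>)" if "P \<epsilon>" "\<epsilon> > 0" for \<epsilon>
  proof -
    have U1: "\<forall>\<^sub>F n in sequentially. \<bar>U $ n - \<alpha> * c $ n\<bar> \<le> (5/4 * \<epsilon>) * c $ n"
      using \<open>P \<epsilon>\<close> unfolding P_def
    proof eventually_elim
      case (elim n)
      moreover have "\<epsilon> * c $ n \<le> (5/4 * \<epsilon>) * c $ n"
        using that by (intro mult_right_mono) (auto simp: nonneg)
      ultimately show ?case by linarith
    qed
    have E1: "\<forall>\<^sub>F n in sequentially. \<bar>E $ n - \<beta> * c $ n\<bar> \<le> (5/4 * \<epsilon>) * c $ n"
      using \<open>P \<epsilon>\<close> T_bound[of "\<epsilon>/4", simplified, OF \<open>\<epsilon> > 0\<close>] unfolding P_def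
    proof eventually_elim
      case (elim n)
      have "E $ n - \<beta> * c $ n = (T $ n - \<tau> * c $ n) - (U $ n - \<alpha> * c $ n)"
        by (simp add: sum \<beta>_def algebra_simps)
      then have "\<bar>E $ n - \<beta> * c $ n\<bar> \<le> \<bar>T $ n - \<tau> * c $ n\<bar> + \<bar>U $ n - \<alpha> * c $ n\<bar>"
        by (simp only: abs_triangle_ineq4)
      also have "\<dots> \<le> \<epsilon> * c $ n / 4 + \<epsilon> * c $ n"
        using elim by (intro add_mono) simp_all
      finally show ?case by (simp add: algebra_simps)
    qed
    have "\<forall>\<^sub>F n in sequentially. \<bar>(U * E) $ n - (u * \<beta> + e * \<alpha>) * c $ n\<bar>
        \<le> ((u + e) * (5/4 * \<epsilon>) + \<epsilon>/16) * c $ n"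
      using that EU_nonneg le U_sums E_sums U1 E1 by (intro convolution_asymptotics) auto
    then show ?thesis
      unfolding P_def fixpoint using T_bound[of "\<epsilon>/16", simplified, OF \<open>\<epsilon> > 0\<close>]
        eventually_ge_at_top[of 2]
    proof eventually_elim
      case (elim n)
      have "(u + e) * (5/4 * \<epsilon>) \<le> 1/2 * (5/4 * \<epsilon>)"
        using that w \<open>w \<le> 1/2\<close> by (intro mult_right_mono) auto
      then have "((u + e) * (5/4 * \<epsilon>) + \<epsilon>/16) * c $ n \<le> (11/16 * \<epsilon>) * c $ n"
        using pos[of n] elim by (intro mult_right_mono) auto
      \<comment> \<open>From degree 2 on the linear term is absent, so \<open>E\<close> and
        \<open>U * E\<close> have equal coefficients.\<close>
      then have E2: "\<bar>E $ n - \<beta> * c $ n\<bar> \<le> (11/16 * \<epsilon>) * c $ n"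
        using elim E_nth[of n] by simp
      have "U $ n - \<alpha> * c $ n = (T $ n - \<tau> * c $ n) - (E $ n - \<beta> * c $ n)"
        by (simp add: sum \<beta>_def algebra_simps)
      then have "\<bar>U $ n - \<alpha> * c $ n\<bar> \<le> \<bar>T $ n - \<tau> * c $ n\<bar> + \<bar>E $ n - \<beta> * c $ n\<bar>"
        by (simp only: abs_triangle_ineq4)
      also have "\<dots> \<le> \<epsilon> * c $ n / 16 + (11/16 * \<epsilon>) * c $ n"
        using elim(2) E2 by (intro add_mono) simp_all
      finally show ?case by (simp add: algebra_simps)
    qed
  qed
  have iterate: "P ((3/4) ^ k * (1 + \<bar>\<alpha>\<bar>))" for k
  proof (induction k)
    case 0
    \<comment> \<open>The crude bound \<open>0 \<le> U $ n \<le> c $ n\<close> is enough to start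
      the iteration.\<close>
    have "\<bar>U $ n - \<alpha> * c $ n\<bar> \<le> (1 + \<bar>\<alpha>\<bar>) * c $ n" if "n \<ge> 1" for n
    proof -
      have "\<bar>U $ n - \<alpha> * c $ n\<bar> \<le> \<bar>U $ n\<bar> + \<bar>\<alpha> * c $ n\<bar>" by linarith
      also have "\<dots> \<le> c $ n + \<bar>\<alpha>\<bar> * c $ n"
        using EU_nonneg[of n] le[of n] pos[OF that] by (simp add: abs_mult)
      finally show ?thesis by (simp add: algebra_simps)
    qed
    then show ?case
      unfolding P_def using eventually_sequentially by auto
  next
    case (Suc k)
    show ?case using improve[OF Suc] by (simp add: mult.assoc)
  qed
  have "\<forall>\<delta>>0. \<forall>\<^sub>F n in sequentially. \<bar>U $ n - \<alpha> * c $ n\<bar> \<le> \<delta> * c $ n"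
  proof (intro allI impI)
    fix \<delta> :: real assume "\<delta> > 0"
    have "(\<lambda>k. (3/4) ^ k * (1 + \<bar>\<alpha>\<bar>)) \<longlonglongrightarrow> 0 * (1 + \<bar>\<alpha>\<bar>)"
      by (intro tendsto_mult LIMSEQ_power_zero tendsto_const) auto
    then have "\<forall>\<^sub>F k in sequentially. (3/4) ^ k * (1 + \<bar>\<alpha>\<bar>) < \<delta>"
      using \<open>\<delta> > 0\<close> by (intro order_tendstoD) auto
    then obtain k where k: "(3/4) ^ k * (1 + \<bar>\<alpha>\<bar>) < \<delta>"
      by (auto dest!: eventually_happens)
    show "\<forall>\<^sub>F n in sequentially. \<bar>U $ n - \<alpha> * c $ n\<bar> \<le> \<delta> * c $ n"
      using iterate[of k] eventually_ge_at_top[of 1] unfolding P_def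
    proof eventually_elim
      case (elim n)
      have "(3/4) ^ k * (1 + \<bar>\<alpha>\<bar>) * c $ n \<le> \<delta> * c $ n"
        using k nonneg by (intro mult_right_mono) auto
      with elim(1) show ?case by (rule order_trans)
    qed
  qed
  then have "(\<lambda>n. U $ n / c $ n) \<longlonglongrightarrow> \<alpha>"
    using tendsto_ratio_iff[OF pos, where a = "fps_nth U" and \<alpha> = \<alpha>] by auto
  then show "(\<lambda>n. U $ n / c $ n) \<longlonglongrightarrow> \<tau> * (1/2 * (1 + (1 - w) / sqrt ((1 - w)\<^sup>2 + 4 * r)))"
    unfolding s \<alpha>_def .
qed
end

section \<open>Counting valuations by decomposition at the root\<close>

text \<open>The domain is the leaf set of the formula, so that subformulas are covered; the
  predicate serves both single values and thresholds.\<close>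

definition valuations :: "'a::{linorder,one} set \<Rightarrow> ('a \<Rightarrow> bool) \<Rightarrow> fm \<Rightarrow> (nat \<Rightarrow> 'a) set" where
  "valuations V P f = {\<sigma> \<in> set (leaves f) \<rightarrow>\<^sub>E V. P (eval_fm \<sigma> f)}"

definition eval_count :: "'a::{linorder,one} set \<Rightarrow> ('a \<Rightarrow> bool) \<Rightarrow> nat \<Rightarrow> nat" where
  "eval_count V P n = (\<Sum>f\<in>bracketings n. card (valuations V P f))"

text \<open>The right side of a bracketing has leaves \<open>k + 1, ..., n\<close>; a shift of
  variables makes it a bracketing of \<open>n - k\<close> variables.\<close>

primrec relabel :: "(nat \<Rightarrow> nat) \<Rightarrow> fm \<Rightarrow> fm" where
  "relabel h (Var i) = Var (h i)"
| "relabel h (Imp a b) = Imp (relabel h a) (relabel h b)"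

lemma leaves_relabel [simp]: "leaves (relabel h f) = map h (leaves f)"
  by (induction f) auto

lemma eval_relabel: "eval_fm \<sigma> (relabel h f) = eval_fm (\<sigma> \<circ> h) f"
  by (induction f) auto

lemma relabel_relabel: "relabel g (relabel h f) = relabel (g \<circ> h) f"
  by (induction f) auto

lemma relabel_ident: "(\<And>i. i \<in> set (leaves f) \<Longrightarrow> h i = i) \<Longrightarrow> relabel h f = f"
  by (induction f) auto

lemma eval_cong: "(\<And>i. i \<in> set (leaves f) \<Longrightarrow> \<sigma> i = \<tau> i) \<Longrightarrow> eval_fm \<sigma> f = eval_fm \<tau> f"
  by (induction f) auto

lemma eval_in:
  "(\<And>i. i \<in> set (leaves f) \<Longrightarrow> \<sigma> i \<in> V) \<Longrightarrow> 1 \<in> V \<Longrightarrow> eval_fm \<sigma> f \<in> V"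
  by (induction f) (auto simp: goedel_imp_def)

lemma finite_bracketings [simp]: "finite (bracketings n)"
  unfolding bracketings_def by (rule finite_leaves)

lemma finite_valuations: "finite V \<Longrightarrow> finite (valuations V P f)"
  unfolding valuations_def by (rule finite_subset[of _ "set (leaves f) \<rightarrow>\<^sub>E V"]) (auto intro: finite_PiE)

text \<open>Valuations are transported by composition with \<open>h\<close>, and back with
  \<open>inv h\<close> on the image; restriction keeps them extensional.\<close>

lemma card_valuations_relabel:
  assumes "inj h"
  shows "card (valuations V P (relabel h f)) = card (valuations V P f)"
proof (rule bij_betw_same_card)
  let ?A = "set (leaves f)"
  show "bij_betw (\<lambda>\<sigma>. restrict (\<sigma> \<circ> h) ?A) (valuations V P (relabel h f)) (valuations V P f)"
  proof (rule bij_betw_byWitness[where f' = "\<lambda>\<tau>. restrict (\<tau> \<circ> inv h) (h ` ?A)"])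
    show "(\<lambda>\<sigma>. restrict (\<sigma> \<circ> h) ?A) ` valuations V P (relabel h f) \<subseteq> valuations V P f"
    proof safe
      fix \<sigma> assume \<sigma>: "\<sigma> \<in> valuations V P (relabel h f)"
      have "eval_fm (restrict (\<sigma> \<circ> h) ?A) f = eval_fm (\<sigma> \<circ> h) f"
        by (rule eval_cong) simp
      then show "restrict (\<sigma> \<circ> h) ?A \<in> valuations V P f"
        using \<sigma> by (auto simp: valuations_def eval_relabel)
    qed
    show "(\<lambda>\<tau>. restrict (\<tau> \<circ> inv h) (h ` ?A)) ` valuations V P f \<subseteq> valuations V P (relabel h f)"
    proof safe
      fix \<tau> assume \<tau>: "\<tau> \<in> valuations V P f"
      have "eval_fm (restrict (\<tau> \<circ> inv h) (h ` ?A) \<circ> h) f = eval_fm \<tau> f"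
        by (rule eval_cong) (simp add: assms)
      then show "restrict (\<tau> \<circ> inv h) (h ` ?A) \<in> valuations V P (relabel h f)"
        using \<tau> assms by (auto simp: valuations_def eval_relabel)
    qed
    show "\<forall>\<sigma>\<in>valuations V P (relabel h f). restrict (restrict (\<sigma> \<circ> h) ?A \<circ> inv h) (h ` ?A) = \<sigma>"
      using assms by (auto simp: valuations_def fun_eq_iff restrict_def PiE_def extensional_def)
    show "\<forall>\<tau>\<in>valuations V P f. restrict (restrict (\<tau> \<circ> inv h) (h ` ?A) \<circ> h) ?A = \<tau>"
      using assms by (auto simp: valuations_def fun_eq_iff restrict_def PiE_def extensional_def)
  qed
qed

text \<open>Without shared variables, a valuation of the implication is an arbitrary pair of
  valuations of its sides. The values of both sides stay in \<open>V\<close>, where the condition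
  \<open>R\<close> splits.\<close>

lemma card_valuations_Imp:
  assumes disj: "set (leaves a) \<inter> set (leaves b) = {}" and "1 \<in> V"
    and R: "\<And>x y. x \<in> V \<Longrightarrow> y \<in> V \<Longrightarrow> R (goedel_imp x y) \<longleftrightarrow> P x \<and> Q y"
  shows "card (valuations V R (Imp a b)) = card (valuations V P a) * card (valuations V Q b)"
proof -
  let ?A = "set (leaves a)" and ?B = "set (leaves b)"
  \<comment> \<open>Outside both leaf sets \<open>\<tau>\<close> is \<open>undefined\<close>, so the
    joined function is again extensional.\<close>
  let ?join = "\<lambda>(\<sigma>, \<tau>) i. if i \<in> ?A then \<sigma> i else \<tau> i"
  have R': "R (eval_fm \<sigma> (Imp a b)) \<longleftrightarrow> P (eval_fm \<sigma> a) \<and> Q (eval_fm \<sigma> b)"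
    if "\<sigma> \<in> (?A \<union> ?B) \<rightarrow>\<^sub>E V" for \<sigma>
  proof -
    have "eval_fm \<sigma> a \<in> V" "eval_fm \<sigma> b \<in> V"
      using that \<open>1 \<in> V\<close> by (auto intro!: eval_in)
    then show ?thesis by (simp add: R)
  qed
  have "bij_betw (\<lambda>\<sigma>. (restrict \<sigma> ?A, restrict \<sigma> ?B)) (valuations V R (Imp a b))
      (valuations V P a \<times> valuations V Q b)"
  proof (rule bij_betw_byWitness[where f' = ?join])
    show "(\<lambda>\<sigma>. (restrict \<sigma> ?A, restrict \<sigma> ?B)) ` valuations V R (Imp a b)
        \<subseteq> valuations V P a \<times> valuations V Q b"
    proof safe
      fix \<sigma> assume "\<sigma> \<in> valuations V R (Imp a b)"
      moreover have "eval_fm (restrict \<sigma> ?A) a = eval_fm \<sigma> a" "eval_fm (restrict \<sigma> ?B) b = eval_fm \<sigma> b"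
        by (auto intro!: eval_cong)
      ultimately show "restrict \<sigma> ?A \<in> valuations V P a" "restrict \<sigma> ?B \<in> valuations V Q b"
        using R' by (auto simp: valuations_def simp del: eval_fm.simps)
    qed
    show "?join ` (valuations V P a \<times> valuations V Q b) \<subseteq> valuations V R (Imp a b)"
    proof (rule image_subsetI)
      fix p assume "p \<in> valuations V P a \<times> valuations V Q b"
      then obtain \<sigma> \<tau> where p: "p = (\<sigma>, \<tau>)" and *: "\<sigma> \<in> valuations V P a" "\<tau> \<in> valuations V Q b"
        by blast
      have "eval_fm (?join (\<sigma>, \<tau>)) a = eval_fm \<sigma> a" "eval_fm (?join (\<sigma>, \<tau>)) b = eval_fm \<tau> b"
        using disj by (auto intro!: eval_cong)
      moreover have "?join (\<sigma>, \<tau>) \<in> (?A \<union> ?B) \<rightarrow>\<^sub>E V"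
        using * disj by (auto simp: valuations_def PiE_def extensional_def)
      ultimately show "?join p \<in> valuations V R (Imp a b)"
        using * R'[of "?join (\<sigma>, \<tau>)"] by (simp add: p valuations_def del: eval_fm.simps)
    qed
    show "\<forall>\<sigma>\<in>valuations V R (Imp a b). ?join (restrict \<sigma> ?A, restrict \<sigma> ?B) = \<sigma>"
      by (auto simp: valuations_def fun_eq_iff restrict_def PiE_def extensional_def)
    show "\<forall>p\<in>valuations V P a \<times> valuations V Q b. (restrict (?join p) ?A, restrict (?join p) ?B) = p"
      using disj by (auto simp: valuations_def fun_eq_iff restrict_def PiE_def extensional_def)
  qed
  then show ?thesis
    by (simp add: bij_betw_same_card card_cartesian_product)
qed

text \<open>With at least two leaves the root is an implication; \<open>k\<close> is the number of
  leaves on its left, and the right side is represented by its shift down to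
  \<open>1, ..., n - k\<close>.\<close>

lemma sum_bracketings:
  fixes F :: "fm \<Rightarrow> nat"
  assumes "n \<ge> 2"
  shows "(\<Sum>f\<in>bracketings n. F f)
    = (\<Sum>k=1..<n. \<Sum>a\<in>bracketings k. \<Sum>b\<in>bracketings (n - k). F (Imp a (relabel ((+) k) b)))"
proof -
  let ?S = "SIGMA k:{1..<n}. bracketings k \<times> bracketings (n - k)"
  have "(\<Sum>f\<in>bracketings n. F f) = (\<Sum>(k, a, b)\<in>?S. F (Imp a (relabel ((+) k) b)))"
  proof (rule sum.reindex_bij_witness[of _ "\<lambda>(k, a, b). Imp a (relabel ((+) k) b)"
      "\<lambda>f. case f of Imp a b \<Rightarrow> (length (leaves a), a, relabel (\<lambda>i. i - length (leaves a)) b)"])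
    fix f assume f: "f \<in> bracketings n"
    then have "length (leaves f) = n"
      by (simp add: bracketings_def del: upt_Suc)
    then obtain a b where ab: "f = Imp a b"
      using assms by (cases f) auto
    define k where "k = length (leaves a)"
    have l: "leaves a @ leaves b = [1..<Suc n]"
      using f ab by (simp add: bracketings_def)
    have "k + length (leaves b) = n"
      using arg_cong[OF l, of length] by (simp add: k_def del: upt_Suc)
    moreover have "k \<noteq> 0" "length (leaves b) \<noteq> 0"
      unfolding k_def using leaves_nonempty by auto
    ultimately have k: "1 \<le> k" "k < n" by auto
    have a: "leaves a = [1..<Suc k]"
      using arg_cong[OF l, of "take k"] k by (simp add: k_def take_upt del: upt_Suc)
    have b: "leaves b = [Suc k..<Suc n]"
      using arg_cong[OF l, of "drop k"] k by (simp add: k_def del: upt_Suc)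
    \<comment> \<open>All leaves of \<open>b\<close> exceed \<open>k\<close>, so adding
      \<open>k\<close> undoes the truncated subtraction.\<close>
    have b': "relabel ((+) k) (relabel (\<lambda>i. i - k) b) = b"
      unfolding relabel_relabel by (rule relabel_ident) (auto simp: b)
    have b'': "map (\<lambda>i. i - k) (leaves b) = [1..<Suc (n - k)]"
      unfolding b using k by (intro nth_equalityI) (auto simp del: upt_Suc)
    show "(case case f of Imp a b \<Rightarrow> (length (leaves a), a, relabel (\<lambda>i. i - length (leaves a)) b)
        of (k, a, b) \<Rightarrow> Imp a (relabel ((+) k) b)) = f"
      using b' by (simp add: ab k_def)
    then show "(case case f of Imp a b \<Rightarrow> (length (leaves a), a, relabel (\<lambda>i. i - length (leaves a)) b)
        of (k, a, b) \<Rightarrow> F (Imp a (relabel ((+) k) b))) = F f"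
      by (simp add: ab)
    show "(case f of Imp a b \<Rightarrow> (length (leaves a), a, relabel (\<lambda>i. i - length (leaves a)) b)) \<in> ?S"
      using a b'' k by (simp add: ab bracketings_def flip: k_def del: upt_Suc)
  next
    fix p assume "p \<in> ?S"
    then obtain k a b where p: "p = (k, a, b)" and k: "1 \<le> k" "k < n"
      and a: "leaves a = [1..<Suc k]" and b: "leaves b = [1..<Suc (n - k)]"
      by (auto simp: bracketings_def simp del: upt_Suc)
    have "relabel (\<lambda>i. i - k) (relabel ((+) k) b) = b"
      unfolding relabel_relabel by (rule relabel_ident) simp
    then show "(case case p of (k, a, b) \<Rightarrow> Imp a (relabel ((+) k) b) of
        Imp a b \<Rightarrow> (length (leaves a), a, relabel (\<lambda>i. i - length (leaves a)) b)) = p"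
      by (simp add: p a del: upt_Suc)
    have "[1..<Suc k] @ map ((+) k) [1..<Suc (n - k)] = [1..<Suc n]"
      using k by (intro nth_equalityI) (auto simp: nth_append simp del: upt_Suc)
    then show "(case p of (k, a, b) \<Rightarrow> Imp a (relabel ((+) k) b)) \<in> bracketings n"
      by (simp add: p bracketings_def a b del: upt_Suc)
  qed
  also have "\<dots> = (\<Sum>k=1..<n. \<Sum>(a, b)\<in>bracketings k \<times> bracketings (n - k). F (Imp a (relabel ((+) k) b)))"
    by (subst sum.Sigma) auto
  also have "\<dots> = (\<Sum>k=1..<n. \<Sum>a\<in>bracketings k. \<Sum>b\<in>bracketings (n - k). F (Imp a (relabel ((+) k) b)))"
    by (simp only: sum.cartesian_product)
  finally show ?thesis .
qed

text \<open>A condition on the value that splits over the two arguments turns the Catalan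
  decomposition into a convolution of counts.\<close>

lemma eval_count_Imp:
  assumes "n \<ge> 2" "1 \<in> V"
    and "\<And>x y. x \<in> V \<Longrightarrow> y \<in> V \<Longrightarrow> R (goedel_imp x y) \<longleftrightarrow> P x \<and> Q y"
  shows "eval_count V R n = (\<Sum>k=1..<n. eval_count V P k * eval_count V Q (n - k))"
proof -
  have "card (valuations V R (Imp a (relabel ((+) k) b)))
      = card (valuations V P a) * card (valuations V Q b)"
    if "a \<in> bracketings k" "b \<in> bracketings (n - k)" for a b k
  proof -
    have "set (leaves a) \<inter> set (leaves (relabel ((+) k) b)) = {}"
      using that by (auto simp: bracketings_def simp del: upt_Suc)
    then show ?thesis
      using assms(2,3) by (subst card_valuations_Imp) (auto simp: card_valuations_relabel)
  qed
  then show ?thesis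
    unfolding eval_count_def sum_bracketings[OF assms(1)] sum_product
    by (intro sum.cong refl) auto
qed

lemma eval_count_cong:
  assumes "1 \<in> V" "\<And>x. x \<in> V \<Longrightarrow> P x \<longleftrightarrow> Q x"
  shows "eval_count V P n = eval_count V Q n"
proof -
  have "valuations V P f = valuations V Q f" for f
    using assms eval_in[of f _ V] by (auto simp: valuations_def PiE_iff)
  then show ?thesis by (simp add: eval_count_def)
qed

lemma eval_count_mono:
  assumes "finite V" "\<And>x. P x \<Longrightarrow> Q x"
  shows "eval_count V P n \<le> eval_count V Q n"
  unfolding eval_count_def by (intro sum_mono card_mono finite_valuations) (use assms in \<open>auto simp: valuations_def\<close>)

lemma eval_count_disj:
  assumes "finite V" "\<And>x. \<not> (P x \<and> Q x)"
  shows "eval_count V (\<lambda>x. P x \<or> Q x) n = eval_count V P n + eval_count V Q n"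
proof -
  have "card (valuations V (\<lambda>x. P x \<or> Q x) f) = card (valuations V P f) + card (valuations V Q f)" for f
  proof -
    have "valuations V (\<lambda>x. P x \<or> Q x) f = valuations V P f \<union> valuations V Q f"
      by (auto simp: valuations_def)
    moreover have "valuations V P f \<inter> valuations V Q f = {}"
      using assms(2) by (auto simp: valuations_def)
    ultimately show ?thesis
      by (simp add: card_Un_disjoint finite_valuations assms(1))
  qed
  then show ?thesis by (simp add: eval_count_def sum.distrib)
qed

lemma eval_count_0: "eval_count V P 0 = 0"
  using leaves_nonempty by (simp add: eval_count_def bracketings_def)

lemma eval_count_1: "eval_count V P 1 = card {x \<in> V. P x}"
proof -
  have "leaves f = [1] \<longleftrightarrow> f = Var 1" for f
  proof (cases f)
    case (Imp a b)
    then show ?thesis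
      using leaves_nonempty[of a] leaves_nonempty[of b]
      by (cases "leaves a"; cases "leaves b") auto
  qed simp
  then have "bracketings 1 = {Var 1}"
    by (simp add: bracketings_def)
  moreover have "valuations V P (Var 1) = {1} \<rightarrow>\<^sub>E {x \<in> V. P x}"
    by (rule set_eqI) (simp add: valuations_def PiE_iff, blast)
  ultimately show ?thesis
    by (simp add: eval_count_def card_PiE)
qed

section \<open>From the counts to generating functions\<close>

lemma gcount_eq_eval_count: "gcount m v j n = eval_count (v ` {..<m}) (\<lambda>x. x = v j) n"
proof -
  have "{(f, \<sigma>). f \<in> bracketings n \<and> \<sigma> \<in> {1..n} \<rightarrow>\<^sub>E v ` {..<m} \<and> eval_fm \<sigma> f = v j}
    = (SIGMA f:bracketings n. valuations (v ` {..<m}) (\<lambda>x. x = v j) f)"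
    by (auto simp: valuations_def bracketings_def atLeastLessThanSuc_atLeastAtMost simp del: upt_Suc)
  then show ?thesis
    unfolding gcount_def eval_count_def by (simp add: finite_valuations)
qed

lemma gtotal_eq_eval_count:
  assumes "inj_on v {..<m}" "1 \<in> v ` {..<m}"
  shows "gtotal m v n = eval_count (v ` {..<m}) (\<lambda>x. True) n"
proof -
  have "(\<Sum>j<m'. eval_count (v ` {..<m}) (\<lambda>x. x = v j) n)
      = eval_count (v ` {..<m}) (\<lambda>x. x \<in> v ` {..<m'}) n"
    if "m' \<le> m" for m'
    using that
  proof (induction m')
    case 0
    then show ?case by (simp add: eval_count_def valuations_def)
  next
    case (Suc m')
    have "v m' \<notin> v ` {..<m'}"
      using inj_onD[OF assms(1), of m'] Suc.prems by force
    then have "eval_count (v ` {..<m}) (\<lambda>x. x = v m' \<or> x \<in> v ` {..<m'}) n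
        = eval_count (v ` {..<m}) (\<lambda>x. x = v m') n + eval_count (v ` {..<m}) (\<lambda>x. x \<in> v ` {..<m'}) n"
      by (intro eval_count_disj) auto
    then show ?case
      using Suc by (simp add: lessThan_Suc)
  qed
  from this[of m] show ?thesis
    unfolding gtotal_def gcount_eq_eval_count
    using eval_count_cong[OF assms(2), of "\<lambda>x. x \<in> v ` {..<m}" "\<lambda>x. True"]
    by simp
qed

text \<open>The scaling by the growth rate \<open>4 m\<close> of the total count
  \<open>m^n C_{n-1}\<close> turns the total into the Catalan series above.\<close>

definition eval_gf :: "'a::{linorder,one} set \<Rightarrow> ('a \<Rightarrow> bool) \<Rightarrow> real fps" where
  "eval_gf V P = Abs_fps (\<lambda>n. real (eval_count V P n) / (4 * real (card V)) ^ n)"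

lemma eval_gf_nth [simp]: "eval_gf V P $ n = real (eval_count V P n) / (4 * real (card V)) ^ n"
  by (simp add: eval_gf_def)

text \<open>The linear term counts the values of a single variable; all higher degrees come from an
  implication at the root.\<close>

lemma eval_gf_Imp:
  assumes "1 \<in> V"
    and R: "\<And>x y. x \<in> V \<Longrightarrow> y \<in> V \<Longrightarrow> R (goedel_imp x y) \<longleftrightarrow> P x \<and> Q y"
  shows "eval_gf V R = fps_const (real (card {x \<in> V. R x}) / (4 * real (card V))) * fps_X
    + eval_gf V P * eval_gf V Q"
proof (rule fps_ext)
  fix n :: nat
  consider "n = 0" | "n = 1" | "n \<ge> 2" by linarith
  then show "eval_gf V R $ n
    = (fps_const (real (card {x \<in> V. R x}) / (4 * real (card V))) * fps_X + eval_gf V P * eval_gf V Q) $ n"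
  proof cases
    case 1
    then show ?thesis by (simp add: eval_count_0)
  next
    case 2
    then show ?thesis using eval_count_1[of V R] by (simp add: fps_mult_nth eval_count_0)
  next
    case 3
    let ?M = "4 * real (card V)"
    have "(eval_gf V P * eval_gf V Q) $ n = (\<Sum>k=0..n. eval_gf V P $ k * eval_gf V Q $ (n - k))"
      by (simp add: fps_mult_nth)
    \<comment> \<open>The terms \<open>k = 0\<close> and \<open>k = n\<close> vanish, as there is no
      bracketing of zero variables.\<close>
    also have "\<dots> = (\<Sum>k=1..<n. eval_gf V P $ k * eval_gf V Q $ (n - k))"
      by (rule sum.mono_neutral_right) (auto simp: eval_count_0 le_less not_less_eq)
    also have "\<dots> = (\<Sum>k=1..<n. real (eval_count V P k * eval_count V Q (n - k)) / ?M ^ n)"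
    proof (intro sum.cong refl)
      fix k assume "k \<in> {1..<n}"
      then have "?M ^ k * ?M ^ (n - k) = ?M ^ n"
        by (simp only: power_add[symmetric]) simp
      then show "eval_gf V P $ k * eval_gf V Q $ (n - k)
          = real (eval_count V P k * eval_count V Q (n - k)) / ?M ^ n"
        by (simp only: eval_gf_nth times_divide_times_eq of_nat_mult)
    qed
    also have "\<dots> = real (eval_count V R n) / ?M ^ n"
      using eval_count_Imp[of n V R P Q] 3 assms by (simp add: sum_divide_distrib)
    finally show ?thesis using 3 by simp
  qed
qed

section \<open>The recursion along the chain and the limit\<close>

lemma has_real_derivative_Psi:
  assumes "m > 0"
  shows "(Psi m has_real_derivative 1/2 * (1 + (1 - w) / sqrt ((1 - w)\<^sup>2 + 1 / real m))) (at w)"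
proof -
  have "(1 - w)\<^sup>2 + 1 / real m > 0"
    using assms by (intro add_nonneg_pos) auto
  then show ?thesis
    unfolding Psi_def[abs_def]
    by (auto intro!: derivative_eq_intros simp: field_simps)
qed

theorem proposition7:
  fixes m :: nat and v :: "nat \<Rightarrow> 'a::{linorder,zero,one}"
  assumes "m \<ge> 2" and "is_chain m v"
  shows "((\<lambda>n. real (gcount m v (m - 1) n) / real (gtotal m v n))
           \<longlonglongrightarrow> (\<Prod>k=0..m-2. deriv (Psi m) (wseq m k)))
         \<and> (\<Prod>k=0..m-2. deriv (Psi m) (wseq m k))
           = (\<Prod>k=0..m-2. 1 / 2 * (1 + (1 - wseq m k) / sqrt ((1 - wseq m k)\<^sup>2 + 1 / real m)))"
proof -
  define V where "V = v ` {..<m}"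
  define D where "D k = 1 / 2 * (1 + (1 - wseq m k) / sqrt ((1 - wseq m k)\<^sup>2 + 1 / real m))" for k
  have deriv: "deriv (Psi m) (wseq m k) = D k" for k
    unfolding D_def using assms(1) by (intro DERIV_imp_deriv has_real_derivative_Psi) simp
  have mono: "strict_mono_on {..<m} v" and top: "v (m - 1) = 1"
    using assms(2) by (auto simp: is_chain_def)
  have v_less: "v i < v j \<longleftrightarrow> i < j" and v_le: "v i \<le> v j \<longleftrightarrow> i \<le> j" if "i < m" "j < m" for i j
    using that strict_mono_on_less[OF mono] strict_mono_on_less_eq[OF mono] by auto
  have inj: "inj_on v {..<m}"
    using mono by (rule strict_mono_on_imp_inj_on)
  have card_V: "card V = m"
    unfolding V_def using inj by (simp add: card_image)
  have fin: "finite V" by (simp add: V_def)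
  have "m - 1 < m" using assms(1) by simp
  then have one: "1 \<in> V"
    unfolding V_def top[symmetric] by blast
  have le_one: "x \<le> 1" if "x \<in> V" for x
    using that v_le[of _ "m - 1"] by (auto simp: V_def top[symmetric])

  define c where "c = eval_gf V (\<lambda>_. True)"
  interpret catalan_series c
  proof
    show "c $ 0 = 0" by (simp add: c_def eval_count_0)
    \<comment> \<open>All \<open>m\<close> leaf values count, so the linear coefficient is
      \<open>m / (4 m)\<close>.\<close>
    show "c = fps_const (1/4) * fps_X + c * c"
      using eval_gf_Imp[OF one, of "\<lambda>_. True" "\<lambda>_. True" "\<lambda>_. True"] card_V assms(1)
      by (simp add: c_def)
  qed

  define T where "T k = eval_gf V (\<lambda>x. v k \<le> x)" for k
  define E where "E k = eval_gf V (\<lambda>x. x = v k)" for k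
  \<comment> \<open>Below the top, an implication has value \<open>v k\<close> only through its
    second branch: the consequent is \<open>v k\<close> and the antecedent lies strictly above
    it.\<close>
  have E_eq: "E k = fps_const (1 / (4 * real m)) * fps_X + T (Suc k) * E k" if "Suc k < m" for k
  proof -
    have "{x \<in> V. x = v k} = {v k}" using that by (auto simp: V_def)
    moreover have "(goedel_imp x y = v k) \<longleftrightarrow> (v (Suc k) \<le> x \<and> y = v k)" if "x \<in> V" "y \<in> V" for x y
    proof -
      obtain i where i: "x = v i" "i < m" using \<open>x \<in> V\<close> by (auto simp: V_def)
      have "v k \<noteq> 1"
        using v_less[of k "m - 1"] \<open>Suc k < m\<close> top by auto
      moreover have "v k < x \<longleftrightarrow> v (Suc k) \<le> x"
        using i \<open>Suc k < m\<close> by (simp add: v_less v_le Suc_le_eq)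
      ultimately show ?thesis
        by (auto simp: goedel_imp_def)
    qed
    ultimately show ?thesis
      using eval_gf_Imp[OF one, of "\<lambda>x. x = v k" "\<lambda>x. v (Suc k) \<le> x" "\<lambda>x. x = v k"]
      unfolding E_def T_def by (simp add: card_V)
  qed
  have T_eq: "T k = E k + T (Suc k)" if "Suc k < m" for k
  proof (rule fps_ext)
    fix n
    have "eval_count V (\<lambda>x. v k \<le> x) n = eval_count V (\<lambda>x. x = v k \<or> v (Suc k) \<le> x) n"
    proof (rule eval_count_cong[OF one])
      fix x assume "x \<in> V"
      then obtain i where i: "x = v i" "i < m" by (auto simp: V_def)
      then show "v k \<le> x \<longleftrightarrow> x = v k \<or> v (Suc k) \<le> x"
        using that inj_onD[OF inj, of i k] by (cases "i = k") (auto simp: v_le)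
    qed
    also have "\<dots> = eval_count V (\<lambda>x. x = v k) n + eval_count V (\<lambda>x. v (Suc k) \<le> x) n"
      using v_le[of "Suc k" k] that by (intro eval_count_disj fin) auto
    finally show "T k $ n = (E k + T (Suc k)) $ n"
      by (simp add: T_def E_def add_divide_distrib)
  qed
  have T_le: "T k $ n \<le> c $ n" for k n
    by (auto simp: T_def c_def intro!: divide_right_mono eval_count_mono fin)

  \<comment> \<open>The base case is \<open>T 0 = c\<close>, with sum 1/2 and ratio 1, since
    \<open>v 0\<close> is the bottom; each further threshold adds one factor.\<close>
  have "k < m \<Longrightarrow> (\<lambda>n. T k $ n) sums wseq m k
      \<and> (\<lambda>n. T k $ n / c $ n) \<longlonglongrightarrow> (\<Prod>i<k. D i)" for k
  proof (induction k)
    case 0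
    have "v 0 \<le> x" if "x \<in> V" for x
      using that assms(1) by (auto simp: V_def v_le)
    then have "T 0 = c"
      unfolding T_def c_def using eval_count_cong[OF one, of "\<lambda>x. v 0 \<le> x" "\<lambda>_. True"]
      by (intro fps_ext) simp
    moreover have "(\<lambda>n. c $ n / c $ n) \<longlonglongrightarrow> 1"
      using ratio_shift[of 0] by simp
    ultimately show ?case using sums_half by simp
  next
    case (Suc k)
    have r: "4 * (1 / (4 * real m)) = 1 / real m" "1 / (4 * real m) > 0"
      using assms(1) by auto
    note step = contraction_step[OF T_eq E_eq _ _ T_le r(2), of k "wseq m k" "\<Prod>i<k. D i"]
    have "(\<lambda>n. T (Suc k) $ n) sums ((1 + wseq m k - sqrt ((1 - wseq m k)\<^sup>2 + 4 * (1 / (4 * real m)))) / 2)"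
      by (rule step) (use Suc in \<open>auto simp: T_def E_def\<close>)
    moreover have "(\<lambda>n. T (Suc k) $ n / c $ n) \<longlonglongrightarrow> (\<Prod>i<k. D i) *
        (1/2 * (1 + (1 - wseq m k) / sqrt ((1 - wseq m k)\<^sup>2 + 4 * (1 / (4 * real m)))))"
      by (rule step) (use Suc in \<open>auto simp: T_def E_def\<close>)
    ultimately show ?case
      unfolding r(1) by (simp add: Psi_def D_def)
  qed
  from this[of "m - 1"] have "(\<lambda>n. T (m - 1) $ n / c $ n) \<longlonglongrightarrow> (\<Prod>i<m - 1. D i)"
    using assms(1) by simp
  \<comment> \<open>At the top, being at least \<open>v (m - 1)\<close> means equality, and the
    common scaling cancels in the quotient.\<close>
  moreover have "T (m - 1) $ n / c $ n = real (gcount m v (m - 1) n) / real (gtotal m v n)" for n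
  proof -
    have "eval_count V (\<lambda>x. v (m - 1) \<le> x) n = eval_count V (\<lambda>x. x = v (m - 1)) n"
      unfolding top using le_one by (intro eval_count_cong one) (auto intro: antisym)
    then show ?thesis
      using gtotal_eq_eval_count[OF inj, of n] one assms(1)
      by (simp add: T_def c_def gcount_eq_eval_count card_V flip: V_def)
  qed
  moreover have "{..<m - 1} = {0..m - 2}"
    using assms(1) by auto
  ultimately show ?thesis
    unfolding deriv D_def by simp
qed

end
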